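(* Let $n\ge 3$, let $F$ be a field, and let $T_1,\dots,T_n$ be the companion matrices (with respect to the monomial basis $\mathcal B$ coming from the lexicographic order) of the ideal $I_n\subset R_n=F[x_1,\dots,x_n]$. For each $i\in\{1,\dots,n\}$, the matrix $P_i\in M_{c_n-1}(F)$ obtained from $T_i$ by deleting the first row and the first column (those corresponding to the basis element $1$) is a permutation matrix.
   Context: $I_n\subset R_n=F[x_1,\dots,x_n]$ is the ideal generated by the $n$ binomials $\prod_{j\ne i}x_j-x_i$, $1\le i\le n$. Put $c_n=1+(n-2)2^{n-1}$, which is $\dim_F R_n/I_n$. Fix the lexicographic order with $x_1>\cdots>x_n$. The monomial basis $\mathcal B$ of $R_n/I_n$ consists of (the classes of) the monomials $m(b,T)=x_n^b\prod_{i\in T}x_i$ with $T\subseteq\{2,\dots,n-1\}$ and $0\le b<2n-4$, together with $m(2n-4,\emptyset)=x_n^{2n-4}$; it is ordered so that $1=m(0,\emptyset)$ is the first element. The companion matrix $T_i$ is the $c_n\times c_n$ matrix of the multiplication map $m_{x_i}:R_n/I_n\to R_n/I_n$, $f\mapsto x_if$, with respect to $\mathcal B$, with the convention that the $r$-th row contains the coordinates of $x_i\cdot m_r$, where $m_r$ is the $r$-th element of $\mathcal B$. A permutation matrix is a matrix obtained from the identity matrix by permuting its rows. *)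

theory Defs
  imports
    "Jordan_Normal_Form.Determinant"
    "HOL-Algebra.QuotRing"
    "HOL-Library.Poly_Mapping"
    "HOL-Combinatorics.Permutations"
begin

text \<open>A polynomial over \<open>'a\<close> is a finitely supported map from exponent vectors
  \<open>nat \<Rightarrow>\<^sub>0 nat\<close> to coefficients.  The indeterminates are indexed by all natural numbers;
  \<open>poly_ring n\<close> is the subring in which only the indeterminates 1, ..., n occur.\<close>

type_synonym 'a mpolynomial = "(nat \<Rightarrow>\<^sub>0 nat) \<Rightarrow>\<^sub>0 'a"

definition Const :: "'a::field \<Rightarrow> 'a mpolynomial" where
  "Const a = Poly_Mapping.single 0 a"

definition Var :: "nat \<Rightarrow> 'a::field mpolynomial" where
  "Var i = Poly_Mapping.single (Poly_Mapping.single i 1) 1"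

definition poly_ring :: "nat \<Rightarrow> 'a::field mpolynomial ring" where
  "poly_ring n =
     \<lparr> carrier = {p. \<forall>m \<in> Poly_Mapping.keys p. Poly_Mapping.keys m \<subseteq> {1..n}},
       mult = (*), one = 1, zero = 0, add = (+) \<rparr>"

definition ideal_I :: "nat \<Rightarrow> 'a::field mpolynomial set" where
  "ideal_I n = Idl\<^bsub>poly_ring n\<^esub> ((\<lambda>i. (\<Prod>j\<in>{1..n} - {i}. Var j) - Var i) ` {1..n})"

definition quot_ring :: "nat \<Rightarrow> 'a::field mpolynomial set ring" where
  "quot_ring n = poly_ring n Quot ideal_I n"

definition cls :: "nat \<Rightarrow> 'a::field mpolynomial \<Rightarrow> 'a mpolynomial set" where
  "cls n p = ideal_I n +>\<^bsub>poly_ring n\<^esub> p"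

definition c :: "nat \<Rightarrow> nat" where
  "c n = 1 + (n - 2) * 2 ^ (n - 1)"

definition basis_monomial :: "nat \<Rightarrow> nat \<Rightarrow> nat set \<Rightarrow> 'a::field mpolynomial" where
  "basis_monomial n b T = Var n ^ b * (\<Prod>i\<in>T. Var i)"

text \<open>These are the monomials outside the leading ideal of \<open>ideal_I n\<close> for the lexicographic
  order with \<open>Var 1 > \<dots> > Var n\<close> (where n is at least 3).\<close>

definition basis_monomials :: "nat \<Rightarrow> 'a::field mpolynomial set" where
  "basis_monomials n =
     {basis_monomial n b T | b T. T \<subseteq> {2..n - 1} \<and> b < 2 * n - 4}
     \<union> {basis_monomial n (2 * n - 4) {}}"

text \<open>An admissible ordering of the monomial basis is one that starts with the monomial 1;
  the order of the other monomials is arbitrary.\<close>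

definition basis_ordering :: "nat \<Rightarrow> 'a::field mpolynomial list \<Rightarrow> bool" where
  "basis_ordering n ms \<longleftrightarrow>
     distinct ms \<and> set ms = basis_monomials n \<and> ms ! 0 = basis_monomial n 0 {}"

text \<open>The coordinate vector of an element of the quotient ring, viewed as a vector space through
  the classes of the constants.  It is meaningful because the classes of the monomials in \<open>ms\<close>
  form a basis.\<close>

definition coords ::
  "nat \<Rightarrow> 'a::field mpolynomial list \<Rightarrow> 'a mpolynomial set \<Rightarrow> 'a vec" where
  "coords n ms u = (THE v. v \<in> carrier_vec (c n) \<and>
     u = (\<Oplus>\<^bsub>quot_ring n\<^esub>s\<in>{..<c n}. cls n (Const (v $ s)) \<otimes>\<^bsub>quot_ring n\<^esub> cls n (ms ! s)))"

definition mult_map :: "nat \<Rightarrow> nat \<Rightarrow> 'a::field mpolynomial set \<Rightarrow> 'a mpolynomial set" where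
  "mult_map n i u = cls n (Var i) \<otimes>\<^bsub>quot_ring n\<^esub> u"

text \<open>Row convention: row r holds the coordinates of the image of the r-th basis element.\<close>

definition companion_matrix :: "nat \<Rightarrow> 'a::field mpolynomial list \<Rightarrow> nat \<Rightarrow> 'a mat" where
  "companion_matrix n ms i =
     mat (c n) (c n) (\<lambda>(r, s). coords n ms (mult_map n i (cls n (ms ! r))) $ s)"

definition permutation_matrix :: "'a::field mat \<Rightarrow> bool" where
  "permutation_matrix A \<longleftrightarrow>
     (\<exists>p. p permutes {..<dim_row A} \<and>
        A = mat (dim_row A) (dim_row A) (\<lambda>(r, s). 1\<^sub>m (dim_row A) $$ (p r, s)))"

lemma cring_poly_ring: "cring (poly_ring n :: 'a::field mpolynomial ring)"
proof -
  let ?R = "poly_ring n :: 'a mpolynomial ring"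
  have add: "p + q \<in> carrier ?R" if "p \<in> carrier ?R" "q \<in> carrier ?R" for p q
    using that subsetD[OF Poly_Mapping.keys_add[of p q]] unfolding poly_ring_def by simp blast
  have mult: "p * q \<in> carrier ?R" if pq: "p \<in> carrier ?R" "q \<in> carrier ?R" for p q
  proof -
    have "Poly_Mapping.keys m \<subseteq> {1..n}" if m: "m \<in> Poly_Mapping.keys (p * q)" for m
    proof -
      obtain a b where ab: "a \<in> Poly_Mapping.keys p" "b \<in> Poly_Mapping.keys q" "m = a + b"
        using m keys_mult[of p q] by blast
      then have "Poly_Mapping.keys a \<subseteq> {1..n}" "Poly_Mapping.keys b \<subseteq> {1..n}"
        using pq by (auto simp: poly_ring_def)
      then show ?thesis
        using ab(3) Poly_Mapping.keys_add[of a b] by blast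
    qed
    then show ?thesis by (simp add: poly_ring_def)
  qed
  have zero: "0 \<in> carrier ?R" and one: "1 \<in> carrier ?R"
    by (simp_all add: poly_ring_def)
  have uminus: "- p \<in> carrier ?R" if "p \<in> carrier ?R" for p
    using that by (simp add: poly_ring_def in_keys_iff)
  have ops: "p \<oplus>\<^bsub>?R\<^esub> q = p + q" "p \<otimes>\<^bsub>?R\<^esub> q = p * q"
    "\<zero>\<^bsub>?R\<^esub> = 0" "\<one>\<^bsub>?R\<^esub> = 1" for p q
    by (simp_all add: poly_ring_def)
  have "abelian_group ?R"
  proof (rule abelian_groupI, unfold ops)
    fix p assume p: "p \<in> carrier ?R"
    show "\<exists>q\<in>carrier ?R. q + p = 0"
      by (rule bexI[OF _ uminus[OF p]]) simp
  qed (erule (1) add | rule zero | rule add.assoc add.commute add_0_left)+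
  moreover have "Group.comm_monoid ?R"
    by (rule comm_monoidI, unfold ops)
      (erule (1) mult | rule one | rule mult.assoc mult.commute mult_1_left)+
  ultimately show ?thesis
    by (rule cringI, unfold ops) (rule distrib_right)
qed

lemma Var_in_carrier: "i \<in> {1..n} \<Longrightarrow> Var i \<in> carrier (poly_ring n)"
  by (simp add: poly_ring_def Var_def)

lemma Const_in_carrier: "Const a \<in> carrier (poly_ring n)"
  by (simp add: poly_ring_def Const_def)

end

theory Submission
  imports Defs "HOL-Number_Theory.Cong"
begin

text \<open>The relations say \<open>x\<^sub>i = \<Prod>\<^bsub>j \<noteq> i\<^esub> x\<^sub>j\<close>, an equation between monomials,
  so the quotient ring is the monoid algebra of the commutative monoid \<open>M\<close> with these generators
  and relations.  Multiplying the \<open>i\<close>-th relation by \<open>x\<^sub>i\<close> shows that all squares \<open>x\<^sub>i\<^sup>2\<close> agree with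
  the product of all variables.  Replacing \<open>x\<^sub>1\<close> by \<open>x\<^sub>2 \<cdots> x\<^sub>n\<close> in the relation for \<open>i \<ge> 2\<close> and
  collecting squares gives \<open>x\<^sub>i = x\<^sub>i x\<^sub>n\<^bsup>2n-4\<^esup>\<close>.  Hence \<open>x\<^sub>n\<^bsup>2n-4\<^esup>\<close> is an identity element for every
  nonempty product of variables, and the elements of \<open>M\<close> other than 1 form a group \<open>G\<close>: each
  \<open>x\<^sub>i\<close> acts invertibly on it, since \<open>x\<^sub>i\<^sup>2 = x\<^sub>n\<^sup>2\<close> and a power of \<open>x\<^sub>n\<close> is the identity of \<open>G\<close>.
  The basis monomials represent the elements of \<open>M\<close>, each once.  So multiplication by \<open>x\<^sub>i\<close>
  permutes the basis monomials other than 1, which is the assertion about the matrix with the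
  row and column of 1 removed.

  The formal proof needs two things.  First, \<open>x\<^sub>i\<close> times a basis monomial is congruent to a basis
  monomial; this is the rewriting with the consequences of the relations just described
  (\<open>Var_times_standard\<close>).  Second, the classes of the basis monomials are linearly independent,
  since otherwise coordinates would be meaningless, and multiplication by \<open>x\<^sub>i\<close> is injective on
  the basis monomials other than 1.  Both follow from explicit invariants of an exponent
  vector that determine its image in \<open>M\<close>: whether it is zero, the parities of \<open>a\<^sub>1 + a\<^sub>j\<close> for
  \<open>1 < j < n\<close>, and the residue of \<open>(n - 1) a\<^sub>1 + a\<^sub>2 + \<cdots> + a\<^sub>n\<close> modulo \<open>2n - 4\<close>.  Summing the
  coefficients of a polynomial over all monomials with given invariants is a linear functional
  that vanishes on the ideal (\<open>functional_ideal_I\<close>), and on the basis monomials these functionals are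
  the dual basis (\<open>standard_unique\<close>).  The parities and the residue are additive, hence can be
  cancelled (\<open>same_parities_weight_cancel\<close>), which gives the injectivity.\<close>

section \<open>Arithmetic in the quotient ring\<close>

lemma carrier_poly_ring:
  "p \<in> carrier (poly_ring n) \<longleftrightarrow> (\<forall>m \<in> Poly_Mapping.keys p. Poly_Mapping.keys m \<subseteq> {1..n})"
  by (simp add: poly_ring_def)

lemma poly_ring_ops [simp]:
  "x \<otimes>\<^bsub>poly_ring n\<^esub> y = x * y" "x \<oplus>\<^bsub>poly_ring n\<^esub> y = x + y"
  "\<one>\<^bsub>poly_ring n\<^esub> = 1" "\<zero>\<^bsub>poly_ring n\<^esub> = 0"
  by (simp_all add: poly_ring_def)

lemma mult_in_carrier:
  fixes p q :: "'a::field mpolynomial"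
  assumes "p \<in> carrier (poly_ring n)" "q \<in> carrier (poly_ring n)"
  shows "p * q \<in> carrier (poly_ring n)"
proof -
  interpret R: cring "poly_ring n :: 'a mpolynomial ring" by (rule cring_poly_ring)
  show ?thesis using R.m_closed[OF assms] by simp
qed

lemma add_in_carrier:
  fixes p q :: "'a::field mpolynomial"
  assumes "p \<in> carrier (poly_ring n)" "q \<in> carrier (poly_ring n)"
  shows "p + q \<in> carrier (poly_ring n)"
proof -
  interpret R: cring "poly_ring n :: 'a mpolynomial ring" by (rule cring_poly_ring)
  show ?thesis using R.a_closed[OF assms] by simp
qed

lemma zero_one_in_carrier:
  "0 \<in> carrier (poly_ring n)" "1 \<in> carrier (poly_ring n)"
  by (simp_all add: poly_ring_def)

lemma prod_in_carrier:
  "(\<And>j. j \<in> A \<Longrightarrow> f j \<in> carrier (poly_ring n)) \<Longrightarrow> prod f A \<in> carrier (poly_ring n)"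
  by (induction A rule: infinite_finite_induct) (auto intro: mult_in_carrier zero_one_in_carrier)

lemma sum_in_carrier:
  "(\<And>j. j \<in> A \<Longrightarrow> f j \<in> carrier (poly_ring n)) \<Longrightarrow> sum f A \<in> carrier (poly_ring n)"
  by (induction A rule: infinite_finite_induct) (auto intro: add_in_carrier zero_one_in_carrier)

lemma power_in_carrier:
  "p \<in> carrier (poly_ring n) \<Longrightarrow> p ^ k \<in> carrier (poly_ring n)"
  by (induction k) (auto intro: mult_in_carrier zero_one_in_carrier)

lemma minus_in_carrier:
  "p \<in> carrier (poly_ring n) \<Longrightarrow> q \<in> carrier (poly_ring n) \<Longrightarrow> p - q \<in> carrier (poly_ring n)"
  using Poly_Mapping.keys_diff[of p q] unfolding carrier_poly_ring by blast

lemma a_minus_poly_ring: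
  fixes p q :: "'a::field mpolynomial"
  assumes "p \<in> carrier (poly_ring n)" "q \<in> carrier (poly_ring n)"
  shows "p \<ominus>\<^bsub>poly_ring n\<^esub> q = p - q"
proof -
  interpret R: cring "poly_ring n :: 'a mpolynomial ring" by (rule cring_poly_ring)
  have "\<ominus>\<^bsub>poly_ring n\<^esub> q = - q"
  proof (rule R.minus_equality)
    show "- q \<in> carrier (poly_ring n)"
      using minus_in_carrier[OF zero_one_in_carrier(1) assms(2)] by simp
  qed (use assms in simp_all)
  then show ?thesis by (simp add: a_minus_def)
qed

lemma generators_in_carrier:
  "(\<lambda>i. (\<Prod>j\<in>{1..n} - {i}. Var j) - Var i) ` {1..n} \<subseteq> carrier (poly_ring n)"
  by (auto intro!: minus_in_carrier prod_in_carrier Var_in_carrier)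

lemma ideal_ideal_I: "ideal (ideal_I n :: 'a::field mpolynomial set) (poly_ring n)"
proof -
  interpret R: cring "poly_ring n :: 'a mpolynomial ring" by (rule cring_poly_ring)
  show ?thesis unfolding ideal_I_def by (rule R.genideal_ideal[OF generators_in_carrier])
qed

lemma ring_hom_cring_cls:
  "ring_hom_cring (poly_ring n :: 'a::field mpolynomial ring) (quot_ring n) (cls n)"
proof -
  interpret ideal "ideal_I n :: 'a mpolynomial set" "poly_ring n" by (rule ideal_ideal_I)
  show ?thesis
    using rcos_ring_hom_cring[OF cring_poly_ring] unfolding quot_ring_def cls_def .
qed

lemma cls_mult:
  fixes p q :: "'a::field mpolynomial"
  assumes "p \<in> carrier (poly_ring n)" "q \<in> carrier (poly_ring n)"
  shows "cls n (p * q) = cls n p \<otimes>\<^bsub>quot_ring n\<^esub> cls n q"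
proof -
  interpret h: ring_hom_cring "poly_ring n :: 'a mpolynomial ring" "quot_ring n" "cls n"
    by (rule ring_hom_cring_cls)
  show ?thesis using h.hom_mult[OF assms] by simp
qed

lemma cls_sum:
  fixes f :: "'b \<Rightarrow> 'a::field mpolynomial"
  assumes "finite A" "\<And>s. s \<in> A \<Longrightarrow> f s \<in> carrier (poly_ring n)"
  shows "(\<Oplus>\<^bsub>quot_ring n\<^esub>s\<in>A. cls n (f s)) = cls n (\<Sum>s\<in>A. f s)"
  using assms
proof (induction A)
  interpret h: ring_hom_cring "poly_ring n :: 'a mpolynomial ring" "quot_ring n" "cls n"
    by (rule ring_hom_cring_cls)
  case empty
  show ?case using h.hom_zero by simp
next
  interpret h: ring_hom_cring "poly_ring n :: 'a mpolynomial ring" "quot_ring n" "cls n"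
    by (rule ring_hom_cring_cls)
  case (insert s A)
  have "(\<Oplus>\<^bsub>quot_ring n\<^esub>s\<in>insert s A. cls n (f s))
      = cls n (f s) \<oplus>\<^bsub>quot_ring n\<^esub> cls n (\<Sum>s\<in>A. f s)"
    using insert by (subst h.S.finsum_insert) auto
  also have "\<dots> = cls n (f s + (\<Sum>s\<in>A. f s))"
    using h.hom_add[of "f s" "\<Sum>s\<in>A. f s"] insert.prems
    by (simp add: sum_in_carrier)
  finally show ?case using insert.hyps by simp
qed

text \<open>Carrying the membership in the polynomial ring along makes this a congruence relation that
  needs no side conditions when congruences are chained or multiplied.\<close>

definition cong_I :: "nat \<Rightarrow> 'a::field mpolynomial \<Rightarrow> 'a mpolynomial \<Rightarrow> bool" where
  "cong_I n p q \<longleftrightarrow>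
     p \<in> carrier (poly_ring n) \<and> q \<in> carrier (poly_ring n) \<and> cls n p = cls n q"

lemma cong_I_iff_diff:
  fixes p q :: "'a::field mpolynomial"
  shows "cong_I n p q \<longleftrightarrow>
    p \<in> carrier (poly_ring n) \<and> q \<in> carrier (poly_ring n) \<and> p - q \<in> ideal_I n"
proof -
  interpret R: cring "poly_ring n :: 'a mpolynomial ring" by (rule cring_poly_ring)
  show ?thesis
    using R.quotient_eq_iff_same_a_r_cos[OF ideal_ideal_I, of p q]
    by (auto simp: cong_I_def cls_def a_minus_poly_ring)
qed

lemma cong_I_refl: "p \<in> carrier (poly_ring n) \<Longrightarrow> cong_I n p p"
  by (simp add: cong_I_def)

lemma cong_I_sym: "cong_I n p q \<Longrightarrow> cong_I n q p"
  by (simp add: cong_I_def)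

lemma cong_I_trans [trans]: "cong_I n p q \<Longrightarrow> cong_I n q r \<Longrightarrow> cong_I n p r"
  by (simp add: cong_I_def)

lemma cong_I_mult: "cong_I n p p' \<Longrightarrow> cong_I n q q' \<Longrightarrow> cong_I n (p * q) (p' * q')"
  by (simp add: cong_I_def cls_mult mult_in_carrier)

lemma cong_I_prod:
  "(\<And>j. j \<in> A \<Longrightarrow> cong_I n (f j) (g j)) \<Longrightarrow> cong_I n (prod f A) (prod g A)"
  by (induction A rule: infinite_finite_induct)
    (auto intro: cong_I_mult cong_I_refl zero_one_in_carrier)

section \<open>Reduction to the monomial basis\<close>

lemma cong_I_generator:
  assumes "i \<in> {1..n}"
  shows "cong_I n (\<Prod>j\<in>{1..n} - {i}. Var j) (Var i :: 'a::field mpolynomial)"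
proof -
  interpret R: cring "poly_ring n :: 'a mpolynomial ring" by (rule cring_poly_ring)
  have "(\<Prod>j\<in>{1..n} - {i}. Var j) - (Var i :: 'a mpolynomial) \<in> ideal_I n"
    using R.genideal_self[OF generators_in_carrier] assms unfolding ideal_I_def by blast
  then show ?thesis
    using assms by (auto simp: cong_I_iff_diff intro!: prod_in_carrier Var_in_carrier)
qed

text \<open>Both squares are congruent to the product of all variables: multiply the relation of a
  variable by that variable.\<close>

lemma cong_I_square:
  assumes "i \<in> {1..n}" "j \<in> {1..n}"
  shows "cong_I n (Var i ^ 2) (Var j ^ 2 :: 'a::field mpolynomial)"
proof -
  have *: "cong_I n (\<Prod>j\<in>{1..n}. Var j) (Var i ^ 2 :: 'a mpolynomial)" if "i \<in> {1..n}" for i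
  proof -
    have "cong_I n (Var i * (\<Prod>j\<in>{1..n} - {i}. Var j)) (Var i * Var i :: 'a mpolynomial)"
      using that by (intro cong_I_mult cong_I_generator cong_I_refl Var_in_carrier)
    then show ?thesis
      using that prod.remove[of "{1..n}" i "Var :: nat \<Rightarrow> 'a mpolynomial"]
      by (simp add: power2_eq_square)
  qed
  show ?thesis using cong_I_trans[OF cong_I_sym[OF *] *] assms by blast
qed

lemma cong_I_Var_1:
  assumes "n \<ge> 1"
  shows "cong_I n (Var 1) (\<Prod>j\<in>{2..n}. Var j :: 'a::field mpolynomial)"
proof -
  have "{1..n} - {1} = {2..n}" by auto
  then show ?thesis using cong_I_sym[OF cong_I_generator[of 1 n]] assms by simp
qed

text \<open>Eliminating the first variable from the relation of \<open>Var i\<close> leaves \<open>Var i\<close> times the squares of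
  the other \<open>n - 2\<close> variables, and each square may be replaced by that of \<open>Var n\<close>.\<close>

lemma cong_I_absorb:
  assumes "n \<ge> 3" "i \<in> {2..n}"
  shows "cong_I n (Var i * Var n ^ (2 * n - 4)) (Var i :: 'a::field mpolynomial)"
proof -
  let ?A = "{2..n} - {i}"
  let ?v = "Var :: nat \<Rightarrow> 'a mpolynomial"
  have card: "card ?A = n - 2" using assms by (simp add: card_Diff_singleton)
  have A: "{1..n} - {i} = insert 1 ?A" "1 \<notin> ?A" using assms by auto
  have "cong_I n (?v i) (\<Prod>j\<in>{1..n} - {i}. ?v j)"
    using assms by (intro cong_I_sym[OF cong_I_generator]) auto
  also have "(\<Prod>j\<in>{1..n} - {i}. ?v j) = ?v 1 * (\<Prod>j\<in>?A. ?v j)"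
    unfolding A(1) using A(2) by simp
  also have "cong_I n \<dots> ((\<Prod>j\<in>{2..n}. ?v j) * (\<Prod>j\<in>?A. ?v j))"
    using assms
    by (intro cong_I_mult cong_I_Var_1 cong_I_refl prod_in_carrier Var_in_carrier) auto
  also have "(\<Prod>j\<in>{2..n}. ?v j) * (\<Prod>j\<in>?A. ?v j) = ?v i * (\<Prod>j\<in>?A. ?v j ^ 2)"
    using assms by (simp add: prod.remove[of "{2..n}" i] prod_power_distrib[symmetric]
      power2_eq_square prod.distrib mult.assoc)
  also have "cong_I n \<dots> (?v i * (\<Prod>j\<in>?A. ?v n ^ 2))"
    using assms by (intro cong_I_mult cong_I_prod cong_I_square cong_I_refl Var_in_carrier) auto
  also have "(\<Prod>j\<in>?A. ?v n ^ 2) = ?v n ^ (2 * n - 4)"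
    using card by (simp add: power_mult[symmetric] diff_mult_distrib2)
  finally show ?thesis by (rule cong_I_sym)
qed

lemma basis_monomial_in_carrier:
  assumes "n \<ge> 3" "T \<subseteq> {2..n - 1}"
  shows "basis_monomial n b T \<in> carrier (poly_ring n)"
proof -
  have "T \<subseteq> {1..n}" using assms(2) by force
  then show ?thesis
    using assms(1) unfolding basis_monomial_def
    by (intro mult_in_carrier power_in_carrier prod_in_carrier Var_in_carrier) auto
qed

definition standard :: "nat \<Rightarrow> nat \<Rightarrow> nat set \<Rightarrow> bool" where
  "standard n b T \<longleftrightarrow> T \<subseteq> {2..n - 1} \<and> (b < 2 * n - 4 \<or> b = 2 * n - 4 \<and> T = {})"

lemma basis_monomials_standard:
  "basis_monomials n = {basis_monomial n b T | b T. standard n b T}"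
  by (auto simp: basis_monomials_def standard_def)

text \<open>A monomial that is not yet standard has the factor \<open>Var n ^ (2 * n - 4)\<close> and some further
  variable, which absorbs that factor; this decreases the power of the last variable.\<close>

lemma reduce_to_standard:
  assumes "n \<ge> 3" "T \<subseteq> {2..n - 1}"
  shows "\<exists>b' T'. standard n b' T' \<and>
    cong_I n (basis_monomial n b T) (basis_monomial n b' T' :: 'a::field mpolynomial)"
  using assms(2)
proof (induction b arbitrary: T rule: less_induct)
  case (less b)
  let ?m = "basis_monomial n :: nat \<Rightarrow> nat set \<Rightarrow> 'a mpolynomial"
  have fin: "finite T" using less.prems finite_subset by blast
  show ?case
  proof (cases "standard n b T")
    case True
    then show ?thesis
      using cong_I_refl[OF basis_monomial_in_carrier[OF assms(1) less.prems]] by blast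
  next
    case False
    then have ge: "b \<ge> 2 * n - 4" and "b > 2 * n - 4 \<or> T \<noteq> {}"
      using less.prems by (auto simp: standard_def)
    define k where "k = b - (2 * n - 4)"
    have b: "b = k + (2 * n - 4)" and "k < b" using ge assms(1) by (auto simp: k_def)
    have "\<exists>q j. j \<in> {2..n} \<and> q \<in> carrier (poly_ring n) \<and> ?m k T = q * Var j"
    proof (cases "T = {}")
      case True
      then obtain l where "k = Suc l"
        using \<open>b > 2 * n - 4 \<or> T \<noteq> {}\<close> by (auto simp: k_def gr0_conv_Suc dest!: gr0_implies_Suc)
          (metis Suc_diff_Suc)
      then have "?m k T = Var n ^ l * Var n"
        using True by (simp add: basis_monomial_def mult.commute)
      moreover have "Var n ^ l \<in> carrier (poly_ring n :: 'a mpolynomial ring)"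
        using assms(1) by (intro power_in_carrier Var_in_carrier) auto
      ultimately show ?thesis using assms(1) by (intro exI[of _ "Var n ^ l"] exI[of _ n]) auto
    next
      case False
      then obtain j where j: "j \<in> T" by blast
      then have "?m k T = ?m k (T - {j}) * Var j"
        using fin by (simp add: basis_monomial_def prod.remove[of T j] mult_ac)
      moreover have "?m k (T - {j}) \<in> carrier (poly_ring n)"
        using assms(1) less.prems by (intro basis_monomial_in_carrier) auto
      moreover have "j \<in> {2..n}" using j less.prems by force
      ultimately show ?thesis by blast
    qed
    then obtain q j where j: "j \<in> {2..n}" and q: "q \<in> carrier (poly_ring n)"
      and m: "?m k T = q * Var j" by blast
    have "?m b T = ?m k T * Var n ^ (2 * n - 4)"
      by (simp add: b basis_monomial_def power_add mult_ac)
    also have "\<dots> = q * (Var j * Var n ^ (2 * n - 4))"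
      by (simp add: m mult.assoc)
    also have "cong_I n \<dots> (q * Var j)"
      using assms(1) j q by (intro cong_I_mult cong_I_absorb cong_I_refl)
    finally have "cong_I n (?m b T) (?m k T)" by (simp add: m)
    then show ?thesis
      using less.IH[OF \<open>k < b\<close> less.prems] cong_I_trans by blast
  qed
qed

text \<open>A new variable joins the square-free part, while a repeated one produces a square, which
  moves to the power of the last variable.\<close>

lemma Var_times_square_free:
  assumes n: "n \<ge> 3" and T: "T \<subseteq> {2..n - 1}" and i: "i \<in> {2..n}"
  shows "\<exists>b' T'. T' \<subseteq> {2..n - 1} \<and>
    cong_I n (Var i * basis_monomial n b T) (basis_monomial n b' T' :: 'a::field mpolynomial)"
proof -
  let ?m = "basis_monomial n :: nat \<Rightarrow> nat set \<Rightarrow> 'a mpolynomial"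
  have fin: "finite T" using T finite_subset by blast
  have C: "?m b T \<in> carrier (poly_ring n)" if "T \<subseteq> {2..n - 1}" for b T
    using n that by (rule basis_monomial_in_carrier)
  consider "i = n" | "i \<in> T" | "i \<noteq> n" "i \<notin> T" by blast
  then show ?thesis
  proof cases
    case 1
    then have "Var i * ?m b T = ?m (Suc b) T"
      by (simp add: basis_monomial_def mult_ac)
    then show ?thesis using T cong_I_refl[OF C[OF T, of "Suc b"]] by auto
  next
    case 2
    have T': "T - {i} \<subseteq> {2..n - 1}" using T by blast
    have "Var i * ?m b T = Var i ^ 2 * ?m b (T - {i})"
      unfolding basis_monomial_def prod.remove[OF fin 2] power2_eq_square by (simp only: mult_ac)
    also have "cong_I n \<dots> (Var n ^ 2 * ?m b (T - {i}))"
      using n i T' by (intro cong_I_mult cong_I_square cong_I_refl C) auto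
    also have "Var n ^ 2 * ?m b (T - {i}) = ?m (b + 2) (T - {i})"
      by (simp add: basis_monomial_def power_add power2_eq_square mult_ac)
    finally show ?thesis using T' by blast
  next
    case 3
    then have T': "insert i T \<subseteq> {2..n - 1}" using T i by auto
    have "Var i * ?m b T = ?m b (insert i T)"
      using 3 fin by (simp add: basis_monomial_def mult_ac)
    then show ?thesis using T' cong_I_refl[OF C[OF T', of b]] by metis
  qed
qed

text \<open>The first variable acts as the product of all the others, so only variables
  with index at least 2 have to be multiplied, one after the other.\<close>

lemma Var_times_standard:
  assumes n: "n \<ge> 3" and T: "standard n b T" and i: "i \<in> {1..n}"
  shows "\<exists>b' T'. standard n b' T' \<and>
    cong_I n (Var i * basis_monomial n b T) (basis_monomial n b' T' :: 'a::field mpolynomial)"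
proof -
  let ?m = "basis_monomial n :: nat \<Rightarrow> nat set \<Rightarrow> 'a mpolynomial"
  have T: "T \<subseteq> {2..n - 1}" using T by (simp add: standard_def)
  have many: "\<exists>b' T'. T' \<subseteq> {2..n - 1} \<and> cong_I n ((\<Prod>j\<in>A. Var j) * ?m b T) (?m b' T')"
    if "finite A" "A \<subseteq> {2..n}" for A
    using that
  proof (induction A)
    case empty
    then show ?case using T cong_I_refl[OF basis_monomial_in_carrier[OF n T, of b]] by auto
  next
    case (insert j A)
    then obtain b1 T1 where 1: "T1 \<subseteq> {2..n - 1}" "cong_I n ((\<Prod>j\<in>A. Var j) * ?m b T) (?m b1 T1)"
      by auto
    obtain b2 T2 where 2: "T2 \<subseteq> {2..n - 1}" "cong_I n (Var j * ?m b1 T1) (?m b2 T2)"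
      using Var_times_square_free[OF n 1(1), of j b1, where ?'a = 'a] insert.prems by auto
    have "cong_I n (Var j * ((\<Prod>j\<in>A. Var j) * ?m b T)) (Var j * ?m b1 T1)"
      using insert.prems by (intro cong_I_mult 1(2) cong_I_refl Var_in_carrier) auto
    from cong_I_trans[OF this 2(2)] show ?case
      using 2(1) insert.hyps by (auto simp: mult.assoc)
  qed
  have "\<exists>A. A \<subseteq> {2..n} \<and> cong_I n (Var i) (\<Prod>j\<in>A. Var j :: 'a mpolynomial)"
  proof (cases "i = 1")
    case True
    then show ?thesis using cong_I_Var_1[of n] n by auto
  next
    case False
    then have "{i} \<subseteq> {2..n}" using i by auto
    moreover have "cong_I n (Var i) (\<Prod>j\<in>{i}. Var j :: 'a mpolynomial)"
      using cong_I_refl[OF Var_in_carrier[OF i]] by simp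
    ultimately show ?thesis by blast
  qed
  then obtain A where A: "A \<subseteq> {2..n}" "cong_I n (Var i) (\<Prod>j\<in>A. Var j :: 'a mpolynomial)"
    by blast
  then obtain b1 T1 where 1: "T1 \<subseteq> {2..n - 1}" "cong_I n ((\<Prod>j\<in>A. Var j) * ?m b T) (?m b1 T1)"
    using many[of A] finite_subset by blast
  have "cong_I n (Var i * ?m b T) ((\<Prod>j\<in>A. Var j) * ?m b T)"
    by (intro cong_I_mult A cong_I_refl basis_monomial_in_carrier n T)
  from cong_I_trans[OF this 1(2)] show ?thesis
    using reduce_to_standard[OF n 1(1), of b1] cong_I_trans by blast
qed

section \<open>Functionals vanishing on the ideal\<close>

text \<open>The linear functional on polynomials with the value \<open>\<chi> a\<close> at the monomial with exponent
  vector \<open>a\<close>.\<close>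

definition functional :: "((nat \<Rightarrow>\<^sub>0 nat) \<Rightarrow> 'a) \<Rightarrow> 'a::field mpolynomial \<Rightarrow> 'a" where
  "functional \<chi> p = (\<Sum>a\<in>Poly_Mapping.keys p. \<chi> a * Poly_Mapping.lookup p a)"

lemma functional_superset:
  "finite A \<Longrightarrow> Poly_Mapping.keys p \<subseteq> A \<Longrightarrow> functional \<chi> p = (\<Sum>a\<in>A. \<chi> a * Poly_Mapping.lookup p a)"
  unfolding functional_def by (rule sum.mono_neutral_left) (auto simp: in_keys_iff)

lemma functional_0 [simp]: "functional \<chi> 0 = 0"
  by (simp add: functional_def)

lemma functional_add: "functional \<chi> (p + q) = functional \<chi> p + functional \<chi> q"
proof -
  let ?A = "Poly_Mapping.keys p \<union> Poly_Mapping.keys q"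
  have "functional \<chi> (p + q) = (\<Sum>a\<in>?A. \<chi> a * Poly_Mapping.lookup (p + q) a)"
    using Poly_Mapping.keys_add[of p q] by (intro functional_superset) auto
  also have "\<dots> = functional \<chi> p + functional \<chi> q"
    by (simp add: functional_superset[of ?A] lookup_add distrib_left sum.distrib)
  finally show ?thesis .
qed

lemma functional_minus: "functional \<chi> (p - q) = functional \<chi> p - functional \<chi> q"
  using functional_add[of \<chi> "p - q" q] by simp

lemma functional_sum: "functional \<chi> (sum f A) = (\<Sum>s\<in>A. functional \<chi> (f s))"
  by (induction A rule: infinite_finite_induct) (simp_all add: functional_add)

lemma functional_single [simp]: "functional \<chi> (Poly_Mapping.single a k) = \<chi> a * k"
  by (subst functional_superset[of "{a}"]) auto

lemma sum_single_lookup: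
  fixes p :: "'a \<Rightarrow>\<^sub>0 'b::comm_monoid_add"
  shows "(\<Sum>a\<in>Poly_Mapping.keys p. Poly_Mapping.single a (Poly_Mapping.lookup p a)) = p"
  by (rule poly_mapping_eqI)
    (auto simp: lookup_sum lookup_single when_def in_keys_iff sum.delta)

lemma functional_mult:
  fixes p q :: "'a::field mpolynomial"
  shows "functional \<chi> (p * q) =
    (\<Sum>a\<in>Poly_Mapping.keys p. Poly_Mapping.lookup p a * functional (\<lambda>b. \<chi> (a + b)) q)"
proof -
  have "p * q = (\<Sum>a\<in>Poly_Mapping.keys p. Poly_Mapping.single a (Poly_Mapping.lookup p a)) *
      (\<Sum>b\<in>Poly_Mapping.keys q. Poly_Mapping.single b (Poly_Mapping.lookup q b))"
    by (simp only: sum_single_lookup)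
  also have "functional \<chi> \<dots> = (\<Sum>a\<in>Poly_Mapping.keys p. \<Sum>b\<in>Poly_Mapping.keys q.
      \<chi> (a + b) * (Poly_Mapping.lookup p a * Poly_Mapping.lookup q b))"
    by (simp add: sum_product functional_sum mult_single)
  finally show ?thesis
    by (simp add: functional_def sum_distrib_left mult_ac)
qed

definition square_free_exp :: "nat set \<Rightarrow> nat \<Rightarrow>\<^sub>0 nat" where
  "square_free_exp A = (\<Sum>j\<in>A. Poly_Mapping.single j 1)"

lemma lookup_square_free_exp:
  "finite A \<Longrightarrow> Poly_Mapping.lookup (square_free_exp A) k = of_bool (k \<in> A)"
  by (simp add: square_free_exp_def lookup_sum lookup_single when_def)

lemma prod_Var: "(\<Prod>j\<in>A. Var j) = Poly_Mapping.single (square_free_exp A) 1"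
  unfolding square_free_exp_def
  by (induction A rule: infinite_finite_induct) (simp_all add: Var_def mult_single)

text \<open>These are the functions on exponent vectors that are constant on the classes of the congruence
  generated by the relations.\<close>

definition invariant :: "nat \<Rightarrow> ((nat \<Rightarrow>\<^sub>0 nat) \<Rightarrow> 'a) \<Rightarrow> bool" where
  "invariant n \<chi> \<longleftrightarrow> (\<forall>a. \<forall>i\<in>{1..n}.
     \<chi> (a + square_free_exp ({1..n} - {i})) = \<chi> (a + Poly_Mapping.single i 1))"

lemma invariant_shift: "invariant n \<chi> \<Longrightarrow> invariant n (\<lambda>b. \<chi> (a + b))"
  by (simp add: invariant_def add.assoc[symmetric])

text \<open>The polynomials that are killed by the functionals of all invariant functions form an ideal,
  because multiplication by a monomial only shifts \<open>\<chi>\<close> and shifts preserve invariance.  Quantifying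
  over all invariant functions at once is what makes this set an ideal; it contains the generators.\<close>

lemma functional_ideal_I:
  fixes \<chi> :: "(nat \<Rightarrow>\<^sub>0 nat) \<Rightarrow> 'a::field"
  assumes "invariant n \<chi>" "p \<in> ideal_I n"
  shows "functional \<chi> p = 0"
proof -
  interpret R: cring "poly_ring n :: 'a mpolynomial ring" by (rule cring_poly_ring)
  let ?K = "{p \<in> carrier (poly_ring n). \<forall>\<chi> :: (nat \<Rightarrow>\<^sub>0 nat) \<Rightarrow> 'a. invariant n \<chi> \<longrightarrow> functional \<chi> p = 0}"
  have absorb: "r * p \<in> ?K" if "p \<in> ?K" "r \<in> carrier (poly_ring n)" for p r
    using that by (auto simp: functional_mult invariant_shift intro: mult_in_carrier)
  have neg: "functional \<chi> (\<ominus>\<^bsub>poly_ring n\<^esub> p) = - functional \<chi> p"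
    if "p \<in> carrier (poly_ring n)" for \<chi> and p :: "'a mpolynomial"
  proof -
    have "\<ominus>\<^bsub>poly_ring n\<^esub> p = 0 - p"
      using a_minus_poly_ring[OF zero_one_in_carrier(1) that] that
      by (simp add: a_minus_def)
    then show ?thesis by (simp add: functional_minus[of _ 0, simplified])
  qed
  have "ideal ?K (poly_ring n)"
  proof (rule idealI)
    show "subgroup ?K (add_monoid (poly_ring n))"
      by (rule R.add.subgroupI)
        (auto simp: functional_add neg intro: zero_one_in_carrier add_in_carrier)
    show "x \<otimes>\<^bsub>poly_ring n\<^esub> a \<in> ?K" if "a \<in> ?K" "x \<in> carrier (poly_ring n)" for a x
      using absorb[OF that] by simp
    show "a \<otimes>\<^bsub>poly_ring n\<^esub> x \<in> ?K" if "a \<in> ?K" "x \<in> carrier (poly_ring n)" for a x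
      using absorb[OF that] by (simp add: mult.commute)
  qed (rule R.ring_axioms)
  moreover have "functional \<chi> ((\<Prod>j\<in>{1..n} - {i}. Var j) - Var i) = 0"
    if "invariant n \<chi>" "i \<in> {1..n}" for \<chi> :: "(nat \<Rightarrow>\<^sub>0 nat) \<Rightarrow> 'a" and i
    using that(2) that(1)[unfolded invariant_def, THEN spec[of _ 0]]
    unfolding functional_minus prod_Var by (simp add: Var_def)
  then have "(\<lambda>i. (\<Prod>j\<in>{1..n} - {i}. Var j) - Var i) ` {1..n} \<subseteq> ?K"
    using generators_in_carrier[of n] by blast
  ultimately have "ideal_I n \<subseteq> ?K"
    unfolding ideal_I_def by (rule R.genideal_minimal)
  then show ?thesis using assms by blast
qed

lemma functional_cong_I:
  "invariant n \<chi> \<Longrightarrow> cong_I n p q \<Longrightarrow> functional \<chi> p = functional \<chi> q"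
  using functional_ideal_I[of n \<chi> "p - q"] by (simp add: cong_I_iff_diff functional_minus)

section \<open>Separating the monomial basis\<close>

text \<open>The degree for which the first variable has degree \<open>n - 1\<close> and all others degree 1.  With this choice
  the first relation is homogeneous and, for the others, the two sides have the degrees
  \<open>2 * n - 3\<close> and 1, which agree modulo \<open>2 * n - 4\<close>.\<close>

definition weight :: "nat \<Rightarrow> (nat \<Rightarrow>\<^sub>0 nat) \<Rightarrow> nat" where
  "weight n a = (n - 2) * Poly_Mapping.lookup a 1 + (\<Sum>j\<in>{1..n}. Poly_Mapping.lookup a j)"

text \<open>For exponent vectors supported on \<open>{1..n}\<close>: the monomials become equal after multiplication by
  \<open>Var n ^ (2 * n - 4)\<close>, that is, in the group \<open>G\<close>.  Since the first variable stands for the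
  product of the others, it contributes to every parity.\<close>

definition same_parities_weight :: "nat \<Rightarrow> (nat \<Rightarrow>\<^sub>0 nat) \<Rightarrow> (nat \<Rightarrow>\<^sub>0 nat) \<Rightarrow> bool" where
  "same_parities_weight n a b \<longleftrightarrow>
     (\<forall>j\<in>{2..n - 1}. even (Poly_Mapping.lookup a 1 + Poly_Mapping.lookup a j)
        = even (Poly_Mapping.lookup b 1 + Poly_Mapping.lookup b j))
     \<and> [weight n a = weight n b] (mod (2 * n - 4))"

text \<open>For exponent vectors supported on \<open>{1..n}\<close>: the monomials have the same class in the quotient ring.  The
  zero vector is kept apart: the monomial 1 and \<open>Var n ^ (2 * n - 4)\<close> have the same image in
  \<open>G\<close> but represent different elements of \<open>M\<close>.\<close>

definition same_element :: "nat \<Rightarrow> (nat \<Rightarrow>\<^sub>0 nat) \<Rightarrow> (nat \<Rightarrow>\<^sub>0 nat) \<Rightarrow> bool" where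
  "same_element n a b \<longleftrightarrow> (a = 0 \<longleftrightarrow> b = 0) \<and> same_parities_weight n a b"

lemma weight_add: "weight n (a + b) = weight n a + weight n b"
  by (simp add: weight_def lookup_add sum.distrib algebra_simps)

lemma same_parities_weight_cancel:
  "same_parities_weight n (u + a) (u + b) \<longleftrightarrow> same_parities_weight n a b"
proof -
  have "(even (x + k + (y + l)) = even (x + k' + (y + l'))) = (even (k + l) = even (k' + l'))"
    for x y k l k' l' :: nat by auto
  then show ?thesis
    by (simp only: same_parities_weight_def weight_add cong_add_lcancel_nat lookup_add)
qed

lemma exponent_add_eq_0_iff:
  fixes a b :: "nat \<Rightarrow>\<^sub>0 nat"
  shows "a + b = 0 \<longleftrightarrow> a = 0 \<and> b = 0"
  by (auto simp: poly_mapping_eq_iff lookup_add fun_eq_iff)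

text \<open>The conditions are respected by the defining relations.  For \<open>i = 1\<close> both sides flip all parities
  and for other \<open>i\<close> the product of the other variables flips the \<open>j\<close>-th parity through the first variable
  and again through the \<open>j\<close>-th one unless \<open>j = i\<close>, so that only the \<open>i\<close>-th parity changes (none if
  \<open>i = n\<close>).  Neither side is the monomial 1.\<close>

lemma same_element_relation:
  assumes n: "n \<ge> 3" and i: "i \<in> {1..n}"
  shows "same_element n (square_free_exp ({1..n} - {i})) (Poly_Mapping.single i 1)"
proof -
  let ?a = "square_free_exp ({1..n} - {i})"
  let ?e = "Poly_Mapping.single i (1::nat)"
  have la: "Poly_Mapping.lookup ?a k = of_bool (k \<in> {1..n} - {i})" for k
    by (simp add: lookup_square_free_exp)
  have le: "Poly_Mapping.lookup ?e k = of_bool (k = i)" for k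
    by (simp add: lookup_single when_def)
  have "?e \<noteq> 0" using le[of i] by (metis lookup_zero of_bool_eq_1_iff zero_neq_one)
  moreover have "?a \<noteq> 0"
  proof -
    obtain k where "k \<in> {1..n} - {i}"
      using n i by (metis (full_types) One_nat_def atLeastAtMost_iff Diff_iff singletonD
        le_refl le_trans one_le_numeral numeral_le_one_iff semiring_norm(70))
    then show ?thesis using la[of k] by (auto simp del: Diff_iff)
  qed
  moreover have "even (Poly_Mapping.lookup ?a 1 + Poly_Mapping.lookup ?a j)
      = even (Poly_Mapping.lookup ?e 1 + Poly_Mapping.lookup ?e j)" if "j \<in> {2..n - 1}" for j
    using that i n unfolding la le by auto
  moreover have "[weight n ?a = weight n ?e] (mod (2 * n - 4))"
  proof -
    have sa: "(\<Sum>j\<in>{1..n}. Poly_Mapping.lookup ?a j) = n - 1"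
    proof -
      have "(\<Sum>j\<in>{1..n}. Poly_Mapping.lookup ?a j) = card ({1..n} - {i})"
        unfolding la by (simp add: of_bool_def sum.If_cases Int_def Diff_eq)
      then show ?thesis using i by simp
    qed
    have se: "(\<Sum>j\<in>{1..n}. Poly_Mapping.lookup ?e j) = 1"
      unfolding le using i by (simp add: of_bool_def)
    show ?thesis
    proof (cases "i = 1")
      case True
      then have "weight n ?a = weight n ?e"
        unfolding weight_def sa se la le using n by simp
      then show ?thesis by simp
    next
      case False
      then have "weight n ?a = 1 + (2 * n - 4)" "weight n ?e = 1"
        unfolding weight_def sa se la le using n i by simp_all
      then show ?thesis by (simp only: cong_def mod_add_self2)
    qed
  qed
  ultimately show ?thesis by (simp add: same_element_def same_parities_weight_def)
qed

lemma invariant_indicator: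
  assumes n: "n \<ge> 3"
  shows "invariant n (\<lambda>a. of_bool (same_element n a m) :: 'a::field)"
proof -
  have "same_element n (a + square_free_exp ({1..n} - {i})) m
      = same_element n (a + Poly_Mapping.single i 1) m" if "i \<in> {1..n}" for a i
    using same_element_relation[OF n that]
      same_parities_weight_cancel[of n a "square_free_exp ({1..n} - {i})" "Poly_Mapping.single i 1"]
    unfolding same_element_def exponent_add_eq_0_iff same_parities_weight_def
    by (auto simp: cong_def)
  then show ?thesis by (simp add: invariant_def)
qed

lemma same_element_if_cong_I:
  assumes "n \<ge> 3" "cong_I n (Poly_Mapping.single a (1::'a::field)) (Poly_Mapping.single b 1)"
  shows "same_element n a b"
proof -
  have "same_element n b b" by (simp add: same_element_def same_parities_weight_def)
  then show ?thesis
    using functional_cong_I[OF invariant_indicator[OF assms(1), of b] assms(2)] by simp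
qed

definition basis_exp :: "nat \<Rightarrow> nat \<Rightarrow> nat set \<Rightarrow> nat \<Rightarrow>\<^sub>0 nat" where
  "basis_exp n b T = Poly_Mapping.single n b + square_free_exp T"

lemma basis_monomial_single:
  "basis_monomial n b T = Poly_Mapping.single (basis_exp n b T) (1::'a::field)"
proof -
  have "Var n ^ b = Poly_Mapping.single (Poly_Mapping.single n b) (1::'a)"
    by (induction b) (simp_all add: Var_def mult_single single_add[symmetric])
  then show ?thesis by (simp add: basis_monomial_def basis_exp_def prod_Var mult_single)
qed

text \<open>The parities are those of the square-free part, because the first variable does not occur.
  Once the square-free parts agree, so do the powers of the last variable modulo \<open>2 * n - 4\<close>; the
  exponents 0 and \<open>2 * n - 4\<close> are told apart by the zero test.\<close>

lemma standard_unique: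
  assumes n: "n \<ge> 3" and s: "standard n b T" "standard n b' T'"
    and same: "same_element n (basis_exp n b T) (basis_exp n b' T')"
  shows "b = b' \<and> T = T'"
proof -
  have T: "T \<subseteq> {2..n - 1}" "T' \<subseteq> {2..n - 1}" using s by (auto simp: standard_def)
  have l: "Poly_Mapping.lookup (basis_exp n b T) k = (if k = n then b else of_bool (k \<in> T))"
    if "T \<subseteq> {2..n - 1}" for b T k
  proof -
    have "finite T" "n \<notin> T" using that n finite_subset by auto
    then show ?thesis
      by (auto simp: basis_exp_def lookup_add lookup_single when_def lookup_square_free_exp)
  qed
  have TT: "T = T'"
  proof -
    have "j \<in> T \<longleftrightarrow> j \<in> T'" if "j \<in> {2..n - 1}" for j
    proof -
      have "1 \<notin> T" "1 \<notin> T'" "1 \<noteq> n" "j \<noteq> n" using that n T by auto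
      moreover have "even (Poly_Mapping.lookup (basis_exp n b T) 1 + Poly_Mapping.lookup (basis_exp n b T) j)
          = even (Poly_Mapping.lookup (basis_exp n b' T') 1 + Poly_Mapping.lookup (basis_exp n b' T') j)"
        using same that unfolding same_element_def same_parities_weight_def by blast
      ultimately have "even (of_bool (j \<in> T) :: nat) = even (of_bool (j \<in> T') :: nat)"
        unfolding l[OF T(1)] l[OF T(2)] by simp
      then show ?thesis by (auto simp: of_bool_def split: if_splits)
    qed
    then show ?thesis using T by blast
  qed
  have w: "weight n (basis_exp n b T) = b + weight n (square_free_exp T)" for b
    using n by (simp add: basis_exp_def weight_add) (simp add: weight_def lookup_single when_def)
  have "[b = b'] (mod (2 * n - 4))"
    using same unfolding same_element_def same_parities_weight_def TT[symmetric] w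
    by (simp add: cong_add_rcancel_nat)
  moreover have "b = 0 \<longleftrightarrow> b' = 0" if "T = {}"
  proof -
    have "Poly_Mapping.single n k = 0 \<longleftrightarrow> k = 0" for k :: nat
      by (metis lookup_single_eq lookup_zero single_zero)
    then show ?thesis
      using same that TT by (simp add: same_element_def basis_exp_def square_free_exp_def)
  qed
  ultimately have "b = b'"
    using s TT by (auto simp: standard_def cong_def)
  then show ?thesis using TT by simp
qed

lemma card_basis_monomials:
  assumes n: "n \<ge> 3"
  shows "card (basis_monomials n :: 'a::field mpolynomial set) = c n"
proof -
  let ?S = "{..<2 * n - 4} \<times> Pow {2..n - 1} \<union> {(2 * n - 4, {})}"
  have "basis_monomials n = (\<lambda>(b, T). basis_monomial n b T :: 'a mpolynomial) ` ?S"
    by (auto simp: basis_monomials_def)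
  moreover have "inj_on (\<lambda>(b, T). basis_monomial n b T :: 'a mpolynomial) ?S"
  proof (rule inj_onI, clarify)
    fix b T b' T'
    assume "(b, T) \<in> ?S" "(b', T') \<in> ?S"
      and eq: "basis_monomial n b T = (basis_monomial n b' T' :: 'a mpolynomial)"
    then have s: "standard n b T" "standard n b' T'" by (auto simp: standard_def)
    have "basis_monomial n b T \<in> carrier (poly_ring n :: 'a mpolynomial ring)"
      using s n by (intro basis_monomial_in_carrier) (auto simp: standard_def)
    with eq have "cong_I n (basis_monomial n b T) (basis_monomial n b' T' :: 'a mpolynomial)"
      by (simp add: cong_I_refl)
    then show "b = b' \<and> T = T'"
      using standard_unique[OF n s] same_element_if_cong_I[OF n]
      unfolding basis_monomial_single by blast
  qed
  ultimately have "card (basis_monomials n :: 'a mpolynomial set) = card ?S"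
    by (simp add: card_image)
  also have "\<dots> = (2 * n - 4) * 2 ^ (n - 2) + 1"
    by (subst card_Un_disjoint) (auto simp: card_Pow card_cartesian_product)
  also have "\<dots> = c n"
  proof -
    obtain k where "n = k + 3" using n le_Suc_ex by (metis add.commute)
    then show ?thesis by (simp add: c_def)
  qed
  finally show ?thesis .
qed

section \<open>The companion matrices\<close>

text \<open>The existence of coordinates is clear; the definite description also needs their uniqueness,
  for which the \<open>u\<close>-th coordinate is read off with the functional of the indicator of the
  exponents equivalent to \<open>e u\<close>.\<close>

lemma coords_basis_element:
  fixes ms :: "'a::field mpolynomial list"
  assumes n: "n \<ge> 3" and s: "s < c n"
    and ms: "\<And>s. s < c n \<Longrightarrow> ms ! s \<in> carrier (poly_ring n)"
    and e: "\<And>s. s < c n \<Longrightarrow> ms ! s = Poly_Mapping.single (e s) 1"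
    and inj: "\<And>s t. s < c n \<Longrightarrow> t < c n \<Longrightarrow> same_element n (e s) (e t) \<Longrightarrow> s = t"
  shows "coords n ms (cls n (ms ! s)) = unit_vec (c n) s"
proof -
  have comb: "(\<Oplus>\<^bsub>quot_ring n\<^esub>t\<in>{..<c n}. cls n (Const (v $ t)) \<otimes>\<^bsub>quot_ring n\<^esub> cls n (ms ! t))
      = cls n (\<Sum>t\<in>{..<c n}. Const (v $ t) * ms ! t)" for v :: "'a vec"
  proof -
    interpret h: ring_hom_cring "poly_ring n :: 'a mpolynomial ring" "quot_ring n" "cls n"
      by (rule ring_hom_cring_cls)
    have "(\<Oplus>\<^bsub>quot_ring n\<^esub>t\<in>{..<c n}. cls n (Const (v $ t)) \<otimes>\<^bsub>quot_ring n\<^esub> cls n (ms ! t))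
        = (\<Oplus>\<^bsub>quot_ring n\<^esub>t\<in>{..<c n}. cls n (Const (v $ t) * ms ! t))"
      using ms by (intro h.S.finsum_cong') (auto simp: cls_mult Const_in_carrier mult_in_carrier)
    also have "\<dots> = cls n (\<Sum>t\<in>{..<c n}. Const (v $ t) * ms ! t)"
      using ms by (intro cls_sum) (auto intro: Const_in_carrier mult_in_carrier)
    finally show ?thesis .
  qed
  have C: "(\<Sum>t\<in>{..<c n}. Const (v $ t) * ms ! t) \<in> carrier (poly_ring n)" for v
    using ms by (intro sum_in_carrier mult_in_carrier Const_in_carrier) auto
  have refl: "same_element n a a" for a by (simp add: same_element_def same_parities_weight_def)
  have same: "same_element n (e t) (e u) \<longleftrightarrow> t = u" if "t < c n" "u < c n" for t u
    using inj that refl by blast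
  show ?thesis unfolding coords_def comb
  proof (rule the_equality)
    have "(\<Sum>t\<in>{..<c n}. Const (unit_vec (c n) s $ t) * ms ! t) = ms ! s"
    proof -
      have "(\<Sum>t\<in>{..<c n}. Const (unit_vec (c n) s $ t) * ms ! t)
          = (\<Sum>t\<in>{..<c n}. if t = s then ms ! s else 0)"
        using s by (intro sum.cong) (auto simp: unit_vec_def Const_def)
      then show ?thesis using s by simp
    qed
    then show "unit_vec (c n) s \<in> carrier_vec (c n) \<and>
        cls n (ms ! s) = cls n (\<Sum>t\<in>{..<c n}. Const (unit_vec (c n) s $ t) * ms ! t)"
      by simp
  next
    fix v assume v: "v \<in> carrier_vec (c n) \<and>
        cls n (ms ! s) = cls n (\<Sum>t\<in>{..<c n}. Const (v $ t) * ms ! t)"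
    then have cong: "cong_I n (ms ! s) (\<Sum>t\<in>{..<c n}. Const (v $ t) * ms ! t)"
      using C ms s by (simp add: cong_I_def)
    show "v = unit_vec (c n) s"
    proof (rule eq_vecI)
      fix u assume "u < dim_vec (unit_vec (c n) s :: 'a vec)"
      then have u: "u < c n" by simp
      let ?L = "functional (\<lambda>a. of_bool (same_element n a (e u)) :: 'a)"
      have "?L (ms ! s) = ?L (\<Sum>t\<in>{..<c n}. Const (v $ t) * ms ! t)"
        by (rule functional_cong_I[OF invariant_indicator[OF n] cong])
      also have "\<dots> = (\<Sum>t\<in>{..<c n}. of_bool (t = u) * v $ t)"
        using u by (simp add: functional_sum e Const_def mult_single same)
      also have "\<dots> = v $ u" using u by simp
      finally show "v $ u = unit_vec (c n) s $ u"
        using s u by (simp add: e same unit_vec_def eq_commute)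
    qed (use v in simp)
  qed
qed

text \<open>In the proof, \<open>\<sigma> r\<close> is the position of the basis monomial congruent to \<open>Var i\<close> times the \<open>r\<close>-th one.
  It never takes the value 0 and it is injective away from 0, so that it permutes the nonzero positions.
  Removing the first row and column shifts all positions by one.\<close>

theorem theorem2p1:
  fixes n i :: nat and ms :: "'a::field mpolynomial list"
  assumes "n \<ge> 3"
    and "basis_ordering n ms"
    and "i \<in> {1..n}"
  shows "mat_delete (companion_matrix n ms i) 0 0 \<in> carrier_mat (c n - 1) (c n - 1) \<and>
    permutation_matrix (mat_delete (companion_matrix n ms i) 0 0)"
proof -
  note n = assms(1)
  have dist: "distinct ms" and set: "set ms = basis_monomials n" and "ms ! 0 = basis_monomial n 0 {}"
    using assms(2) by (auto simp: basis_ordering_def)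
  have len: "length ms = c n"
    using distinct_card[OF dist] card_basis_monomials[OF n, where ?'a = 'a] set by simp
  have "\<exists>b T. standard n b T \<and> ms ! s = basis_monomial n b T" if "s < c n" for s
    using nth_mem[of s ms] that len set by (auto simp: basis_monomials_standard)
  then obtain B T where std: "\<And>s. s < c n \<Longrightarrow> standard n (B s) (T s)"
    and BT: "\<And>s. s < c n \<Longrightarrow> ms ! s = basis_monomial n (B s) (T s)" by metis
  define e where "e s = basis_exp n (B s) (T s)" for s
  have e: "ms ! s = Poly_Mapping.single (e s) 1" if "s < c n" for s
    using BT[OF that] by (simp add: e_def basis_monomial_single)
  have C: "ms ! s \<in> carrier (poly_ring n)" if "s < c n" for s
    unfolding BT[OF that] using std[OF that] n
    by (intro basis_monomial_in_carrier) (auto simp: standard_def)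
  have inj: "s = t" if st: "s < c n" "t < c n" and "same_element n (e s) (e t)" for s t
  proof -
    have "B s = B t \<and> T s = T t"
      using that by (intro standard_unique[OF n] std) (simp_all add: e_def)
    then have "ms ! s = ms ! t" using BT st by simp
    then show ?thesis using dist st len nth_eq_iff_index_eq by metis
  qed
  have pos: "0 < c n" by (simp add: c_def)
  have "Poly_Mapping.single (e 0) (1::'a) = Poly_Mapping.single 0 1"
    using \<open>ms ! 0 = basis_monomial n 0 {}\<close> e[OF pos] by (simp add: basis_monomial_def)
  then have e0: "e 0 = 0"
    by (metis keys_single singleton_inject zero_neq_one)
  have e_nonzero: "e s \<noteq> 0" if "s < c n" "s \<noteq> 0" for s
    using inj[OF that(1) pos] that e0 by (auto simp: same_element_def same_parities_weight_def)
  have "\<exists>t < c n. cong_I n (Var i * ms ! r) (ms ! t)" if r: "r < c n" for r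
  proof -
    obtain b' T' where *: "standard n b' T'"
      "cong_I n (Var i * ms ! r) (basis_monomial n b' T')"
      using Var_times_standard[OF n std[OF r] assms(3), where ?'a = 'a] BT[OF r] by metis
    then have "basis_monomial n b' T' \<in> set ms"
      unfolding set basis_monomials_standard by blast
    then show ?thesis using * len by (metis in_set_conv_nth)
  qed
  then obtain \<sigma> where \<sigma>: "\<And>r. r < c n \<Longrightarrow> \<sigma> r < c n"
    and cong: "\<And>r. r < c n \<Longrightarrow> cong_I n (Var i * ms ! r) (ms ! \<sigma> r)" by metis
  have same: "same_element n (Poly_Mapping.single i 1 + e r) (e (\<sigma> r))" if "r < c n" for r
    using cong[OF that] same_element_if_cong_I[OF n] e[OF that] e[OF \<sigma>[OF that]]
    by (simp add: Var_def mult_single)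
  have \<sigma>_nonzero: "\<sigma> r \<noteq> 0" if "r < c n" for r
  proof
    assume "\<sigma> r = 0"
    then have "Poly_Mapping.single i (1::nat) = 0"
      using same[OF that] e0 by (simp add: same_element_def exponent_add_eq_0_iff)
    then show False by (metis lookup_single_eq lookup_zero zero_neq_one)
  qed
  \<comment> \<open>Cancelling \<open>Var i\<close> is valid in the group \<open>G\<close> only, hence the positions other than 0.\<close>
  have \<sigma>_inj: "r = r'" if "r < c n" "r' < c n" "r \<noteq> 0" "r' \<noteq> 0" "\<sigma> r = \<sigma> r'" for r r'
  proof -
    have "same_parities_weight n (Poly_Mapping.single i 1 + e r) (Poly_Mapping.single i 1 + e r')"
      using same[of r] same[of r'] that
      by (auto simp: same_element_def same_parities_weight_def cong_def)
    then have "same_element n (e r) (e r')"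
      using e_nonzero that by (simp add: same_parities_weight_cancel same_element_def)
    then show ?thesis using inj that by blast
  qed
  have entry: "companion_matrix n ms i $$ (r, s) = (if \<sigma> r = s then 1 else 0)"
    if "r < c n" "s < c n" for r s
  proof -
    have "mult_map n i (cls n (ms ! r)) = cls n (ms ! \<sigma> r)"
      using cong[OF that(1)] cls_mult[OF Var_in_carrier[OF assms(3)] C[OF that(1)]]
      by (simp add: mult_map_def cong_I_def)
    then show ?thesis
      using that \<sigma> coords_basis_element[OF n \<sigma>[OF that(1)] C e inj]
      by (auto simp: companion_matrix_def)
  qed
  let ?M = "mat_delete (companion_matrix n ms i) 0 0"
  have dim: "?M \<in> carrier_mat (c n - 1) (c n - 1)"
    by (simp add: mat_delete_def companion_matrix_def)
  define p where "p r = (if r < c n - 1 then \<sigma> (Suc r) - 1 else r)" for r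
  have "p permutes {..<c n - 1}"
  proof (rule bij_imp_permutes)
    have "inj_on p {..<c n - 1}"
    proof (rule inj_onI)
      fix x y assume xy: "x \<in> {..<c n - 1}" "y \<in> {..<c n - 1}" "p x = p y"
      then have "Suc x < c n" "Suc y < c n" "\<sigma> (Suc x) - 1 = \<sigma> (Suc y) - 1"
        by (auto simp: p_def)
      then have "\<sigma> (Suc x) = \<sigma> (Suc y)"
        using \<sigma>_nonzero[of "Suc x"] \<sigma>_nonzero[of "Suc y"] by linarith
      then show "x = y" using \<sigma>_inj[of "Suc x" "Suc y"] xy by auto
    qed
    moreover have "p ` {..<c n - 1} \<subseteq> {..<c n - 1}"
    proof (intro image_subsetI)
      fix x assume "x \<in> {..<c n - 1}"
      then have "x < c n - 1" "Suc x < c n" by auto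
      then show "p x \<in> {..<c n - 1}"
        using \<sigma>[of "Suc x"] \<sigma>_nonzero[of "Suc x"] by (simp add: p_def)
    qed
    ultimately show "bij_betw p {..<c n - 1} {..<c n - 1}"
      by (simp add: bij_betw_def endo_inj_surj)
  qed (simp add: p_def)
  moreover have "?M = mat (c n - 1) (c n - 1) (\<lambda>(r, s). 1\<^sub>m (c n - 1) $$ (p r, s))"
  proof (rule eq_matI)
    fix r s
    assume "r < dim_row (mat (c n - 1) (c n - 1) (\<lambda>(r, s). 1\<^sub>m (c n - 1) $$ (p r, s) :: 'a))"
      and "s < dim_col (mat (c n - 1) (c n - 1) (\<lambda>(r, s). 1\<^sub>m (c n - 1) $$ (p r, s) :: 'a))"
    then have rs: "r < c n - 1" "s < c n - 1" by simp_all
    have "p r < c n - 1" using permutes_in_image[OF \<open>p permutes {..<c n - 1}\<close>, of r] rs by simp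
    moreover have "?M $$ (r, s) = (if \<sigma> (Suc r) = Suc s then 1 else 0)"
      using rs entry[of "Suc r" "Suc s"] by (simp add: mat_delete_def companion_matrix_def)
    moreover have "\<sigma> (Suc r) \<noteq> 0" using rs \<sigma>_nonzero[of "Suc r"] by simp
    then have "\<sigma> (Suc r) = Suc s \<longleftrightarrow> p r = s"
      using rs by (auto simp: p_def)
    ultimately show "?M $$ (r, s) = mat (c n - 1) (c n - 1) (\<lambda>(r, s). 1\<^sub>m (c n - 1) $$ (p r, s)) $$ (r, s)"
      using rs by simp
  qed (use dim in auto)
  ultimately show ?thesis
    using dim by (auto simp: permutation_matrix_def)
qed

end
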